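(* Let $\lambda_1,\ldots,\lambda_n\in\mathbb{F}\setminus\{0\}$ and let $\sigma$ be the field automorphism of $\mathbb{F}(\alpha_1,\ldots,\alpha_n)$ with $\sigma|_{\mathbb{F}}=\mathrm{id}$ and $\sigma(\alpha_i)=\lambda_i\alpha_i$ for $1\le i\le n$. Let $r\in\mathbb{N}$ be the rank of the exponent lattice $U_{\boldsymbol\lambda}$. (1) If $r=0$, then $\mathrm{Const}_\sigma\mathbb{F}(\alpha_1,\ldots,\alpha_n)=\mathbb{F}$. (2) If $r>0$, let $\{\mathbf{a}_1,\ldots,\mathbf{a}_r\}$ be a $\mathbb{Z}$-basis of $U_{\boldsymbol\lambda}$, with $\mathbf{a}_i=(a_{i,1},\ldots,a_{i,n})\in\mathbb{Z}^n$. Then $$\mathrm{Const}_\sigma\mathbb{F}(\alpha_1,\ldots,\alpha_n)=\mathbb{F}(\boldsymbol\alpha^{\mathbf{a}_1},\ldots,\boldsymbol\alpha^{\mathbf{a}_r}),$$ where $\boldsymbol\alpha^{\mathbf{a}_i}=\alpha_1^{a_{i,1}}\alpha_2^{a_{i,2}}\cdots\alpha_n^{a_{i,n}}$ for $i=1,\ldots,r$.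
   Context: $\mathbb{F}$ is a subfield of $\overline{\mathbb{Q}}$, $n\ge1$, and $\mathbb{F}(\alpha_1,\ldots,\alpha_n)$ is the field of rational functions in $n$ variables. The constant field is $\mathrm{Const}_\sigma\mathbb{F}(\alpha_1,\ldots,\alpha_n)=\{f\in\mathbb{F}(\alpha_1,\ldots,\alpha_n)\mid\sigma(f)=f\}$. The exponent lattice of $\boldsymbol\lambda=(\lambda_1,\ldots,\lambda_n)$ is the free $\mathbb{Z}$-module $U_{\boldsymbol\lambda}=\{(i_1,\ldots,i_n)\in\mathbb{Z}^n\mid\lambda_1^{i_1}\cdots\lambda_n^{i_n}=1\}$. For elements $h_1,\ldots,h_r$, $\mathbb{F}(h_1,\ldots,h_r)$ denotes the subfield of $\mathbb{F}(\alpha_1,\ldots,\alpha_n)$ generated over $\mathbb{F}$ by them. *)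

theory Defs
  imports
    "HOL-Analysis.Analysis"
    "HOL-Library.Poly_Mapping"
    "HOL-Computational_Algebra.Polynomial"
    "HOL-Computational_Algebra.Fraction_Field"
begin

(* The n variables are indexed by a type 'n with n elements.  The linear order on 'n is
   only needed because the library's integral domain instance for polynomials asks for it. *)
type_synonym 'n mpolynomial = "('n \<Rightarrow>\<^sub>0 nat) \<Rightarrow>\<^sub>0 complex"
type_synonym 'n ratfun = "'n mpolynomial fract"

definition is_subfield :: "'a::field set \<Rightarrow> bool" where
  "is_subfield K \<longleftrightarrow> 0 \<in> K \<and> 1 \<in> K \<and> (\<forall>x\<in>K. \<forall>y\<in>K. x + y \<in> K) \<and> (\<forall>x\<in>K. - x \<in> K)
     \<and> (\<forall>x\<in>K. \<forall>y\<in>K. x * y \<in> K) \<and> (\<forall>x\<in>K. x \<noteq> 0 \<longrightarrow> inverse x \<in> K)"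

definition field_automorphism_on :: "'a::field set \<Rightarrow> ('a \<Rightarrow> 'a) \<Rightarrow> bool" where
  "field_automorphism_on K \<sigma> \<longleftrightarrow> bij_betw \<sigma> K K \<and> \<sigma> 1 = 1
     \<and> (\<forall>x\<in>K. \<forall>y\<in>K. \<sigma> (x + y) = \<sigma> x + \<sigma> y) \<and> (\<forall>x\<in>K. \<forall>y\<in>K. \<sigma> (x * y) = \<sigma> x * \<sigma> y)"

definition rconst :: "complex \<Rightarrow> 'n::{finite,linorder} ratfun" where
  "rconst c = Fract (Poly_Mapping.single 0 c) 1"

definition rvar :: "'n::{finite,linorder} \<Rightarrow> 'n ratfun" where
  "rvar i = Fract (Poly_Mapping.single (Poly_Mapping.single i 1) 1) 1"

definition polys_over :: "complex set \<Rightarrow> 'n mpolynomial set" where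
  "polys_over F = {p. \<forall>m. Poly_Mapping.lookup p m \<in> F}"

(* F(alpha_1, ..., alpha_n), realised inside the field of rational functions over the
   complex numbers. *)
definition ratfuns_over :: "complex set \<Rightarrow> 'n::{finite,linorder} ratfun set" where
  "ratfuns_over F = {Fract p q | p q. p \<in> polys_over F \<and> q \<in> polys_over F \<and> q \<noteq> 0}"

definition const_field :: "complex set \<Rightarrow> ('n::{finite,linorder} ratfun \<Rightarrow> 'n ratfun) \<Rightarrow> 'n ratfun set" where
  "const_field F \<sigma> = {f \<in> ratfuns_over F. \<sigma> f = f}"

definition field_generated_over :: "complex set \<Rightarrow> 'n::{finite,linorder} ratfun set \<Rightarrow> 'n ratfun set" where
  "field_generated_over F H = is_subfield hull (rconst ` F \<union> H)"

definition laurent_monomial :: "int ^ 'n::{finite,linorder} \<Rightarrow> 'n ratfun" where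
  "laurent_monomial a = (\<Prod>i\<in>UNIV. rvar i powi (a $ i))"

definition exponent_lattice :: "complex ^ 'n::finite \<Rightarrow> (int ^ 'n) set" where
  "exponent_lattice lam = {v. (\<Prod>i\<in>UNIV. (lam $ i) powi (v $ i)) = 1}"

interpretation int_vec: module "(*s) :: int \<Rightarrow> int ^ 'n \<Rightarrow> int ^ 'n::finite"
  by unfold_locales (vector algebra_simps)+

definition is_int_basis :: "(int ^ 'n::finite) set \<Rightarrow> (int ^ 'n) set \<Rightarrow> bool" where
  "is_int_basis B U \<longleftrightarrow> int_vec.independent B \<and> int_vec.span B = U"

(* The rank of a free Z-module as the size of a basis; the library's "dim" is defined in the
   same way, but only for vector spaces.  Every subgroup of Z^n has a finite basis. *)
definition lattice_rank :: "(int ^ 'n::finite) set \<Rightarrow> nat" where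
  "lattice_rank U = card (SOME B. finite B \<and> is_int_basis B U)"

end

theory Submission
  imports Defs
begin

text \<open>
  The automorphism acts diagonally: it multiplies a monomial with exponent vector \<open>m\<close> by the
  scalar \<open>\<chi>(m) = \<lambda>\<^sub>1^m\<^sub>1 \<cdots> \<lambda>\<^sub>n^m\<^sub>n\<close>.  Hence a Laurent monomial is fixed exactly when its
  exponent vector lies in the exponent lattice, and the fixed elements, which form a field, contain
  everything generated by such monomials.

  For the converse, write a fixed element as \<open>f = p / q\<close> with as few monomials in \<open>q\<close> as possible.
  Since \<open>f = \<sigma> p / \<sigma> q\<close> too, also \<open>f = (\<sigma> p - c p) / (\<sigma> q - c q)\<close> for every scalar \<open>c\<close> for which
  the denominator does not vanish.  For \<open>c = \<chi>(m\<^sub>0)\<close> with \<open>m\<^sub>0\<close> a monomial of \<open>q\<close>, the term at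
  \<open>m\<^sub>0\<close> cancels, so minimality forces \<open>\<sigma> q = c q\<close>, and then \<open>\<sigma> p = c p\<close>
  (\<open>fixed_imp_isotypic_quotient\<close>).  Thus all monomials of \<open>p\<close> and \<open>q\<close> have the same scalar
  \<open>c\<close>, and dividing both by the monomial \<open>m\<^sub>0\<close> turns them into combinations of Laurent monomials
  with exponents in the lattice.

  Both parts of the theorem are then the single statement that any spanning set of the lattice
  yields generators of the constant field (\<open>const_field_eq_generated\<close>).  Part (1) is the case of
  the empty spanning set; to pass from rank zero to the lattice being trivial one needs
  that a subgroup of \<open>\<int>^n\<close> has a finite basis at all, which is
  \<open>int_subspace_has_finite_basis\<close>.
\<close>

section \<open>Subfields and homomorphisms defined on them\<close>

lemma is_subfield_hull: "is_subfield (is_subfield hull S)"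
  by (rule hull_in) (auto simp: is_subfield_def)

context
  fixes K :: "'a::field set"
  assumes K: "is_subfield K"
begin

lemma subfield_zero: "0 \<in> K" and subfield_one: "1 \<in> K"
  and subfield_add: "x \<in> K \<Longrightarrow> y \<in> K \<Longrightarrow> x + y \<in> K"
  and subfield_uminus: "x \<in> K \<Longrightarrow> - x \<in> K"
  and subfield_mult: "x \<in> K \<Longrightarrow> y \<in> K \<Longrightarrow> x * y \<in> K"
  using K by (auto simp: is_subfield_def)

lemma subfield_inverse: "x \<in> K \<Longrightarrow> inverse x \<in> K"
  using K by (cases "x = 0") (auto simp: is_subfield_def)

lemma subfield_diff: "x \<in> K \<Longrightarrow> y \<in> K \<Longrightarrow> x - y \<in> K"
  using subfield_add[of x "- y"] subfield_uminus[of y] by simp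

lemma subfield_divide: "x \<in> K \<Longrightarrow> y \<in> K \<Longrightarrow> x / y \<in> K"
  by (simp add: divide_inverse subfield_mult subfield_inverse)

lemma subfield_sum: "(\<And>x. x \<in> A \<Longrightarrow> g x \<in> K) \<Longrightarrow> sum g A \<in> K"
  by (induction A rule: infinite_finite_induct) (auto intro: subfield_zero subfield_add)

lemma subfield_prod: "(\<And>x. x \<in> A \<Longrightarrow> g x \<in> K) \<Longrightarrow> prod g A \<in> K"
  by (induction A rule: infinite_finite_induct) (auto intro: subfield_one subfield_mult)

lemma subfield_power: "x \<in> K \<Longrightarrow> x ^ k \<in> K"
  by (induction k) (auto intro: subfield_one subfield_mult)

lemma subfield_powi: "x \<in> K \<Longrightarrow> x powi k \<in> K"
  by (auto simp: power_int_def intro: subfield_power subfield_inverse)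

end

locale subfield_hom =
  fixes K :: "'a::field set" and \<sigma> :: "'a \<Rightarrow> 'a"
  assumes subfield: "is_subfield K"
    and hom_one: "\<sigma> 1 = 1"
    and hom_add: "x \<in> K \<Longrightarrow> y \<in> K \<Longrightarrow> \<sigma> (x + y) = \<sigma> x + \<sigma> y"
    and hom_mult: "x \<in> K \<Longrightarrow> y \<in> K \<Longrightarrow> \<sigma> (x * y) = \<sigma> x * \<sigma> y"
begin

lemma hom_zero: "\<sigma> 0 = 0"
  using hom_add[of 0 0] subfield_zero[OF subfield] by (metis add_0 add_cancel_right_right)

lemma hom_uminus: "x \<in> K \<Longrightarrow> \<sigma> (- x) = - \<sigma> x"
  using hom_add[of x "- x"] subfield_uminus[OF subfield] hom_zero
  by (metis add.right_inverse minus_unique)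

lemma hom_inverse:
  assumes "x \<in> K" shows "\<sigma> (inverse x) = inverse (\<sigma> x)"
proof (cases "x = 0")
  case False
  then have "\<sigma> x * \<sigma> (inverse x) = 1"
    using hom_mult[of x "inverse x"] assms subfield_inverse[OF subfield] hom_one by simp
  then show ?thesis by (metis inverse_unique)
qed (simp add: hom_zero)

lemma hom_divide: "x \<in> K \<Longrightarrow> y \<in> K \<Longrightarrow> \<sigma> (x / y) = \<sigma> x / \<sigma> y"
  by (simp add: divide_inverse hom_mult hom_inverse subfield_inverse[OF subfield])

lemma hom_sum: "(\<And>x. x \<in> A \<Longrightarrow> g x \<in> K) \<Longrightarrow> \<sigma> (sum g A) = (\<Sum>x\<in>A. \<sigma> (g x))"
  by (induction A rule: infinite_finite_induct)
     (simp_all add: hom_zero hom_add subfield_sum[OF subfield])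

lemma hom_prod: "(\<And>x. x \<in> A \<Longrightarrow> g x \<in> K) \<Longrightarrow> \<sigma> (prod g A) = (\<Prod>x\<in>A. \<sigma> (g x))"
  by (induction A rule: infinite_finite_induct)
     (simp_all add: hom_one hom_mult subfield_prod[OF subfield])

lemma hom_power: "x \<in> K \<Longrightarrow> \<sigma> (x ^ k) = \<sigma> x ^ k"
  by (induction k) (simp_all add: hom_one hom_mult subfield_power[OF subfield])

lemma hom_powi: "x \<in> K \<Longrightarrow> \<sigma> (x powi k) = \<sigma> x powi k"
  by (simp add: power_int_def hom_power hom_inverse subfield_inverse[OF subfield])

lemma fixed_subfield: "is_subfield {x \<in> K. \<sigma> x = x}"
  using subfield
  by (auto simp: is_subfield_def hom_zero hom_one hom_add hom_mult hom_uminus hom_inverse)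

end

section \<open>Polynomials as rational functions\<close>

definition of_mpoly :: "'n::{finite,linorder} mpolynomial \<Rightarrow> 'n ratfun" where
  "of_mpoly p = Fract p 1"

definition ratfun_monomial :: "('n::{finite,linorder} \<Rightarrow>\<^sub>0 nat) \<Rightarrow> 'n ratfun" where
  "ratfun_monomial m = (\<Prod>i\<in>UNIV. rvar i ^ Poly_Mapping.lookup m i)"

lemma of_mpoly_zero [simp]: "of_mpoly 0 = 0"
  and of_mpoly_one [simp]: "of_mpoly 1 = 1"
  by (simp_all add: of_mpoly_def Zero_fract_def One_fract_def)

lemma of_mpoly_add: "of_mpoly (p + q) = of_mpoly p + of_mpoly q"
  and of_mpoly_mult: "of_mpoly (p * q) = of_mpoly p * of_mpoly q"
  and of_mpoly_uminus: "of_mpoly (- p) = - of_mpoly p"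
  by (simp_all add: of_mpoly_def)

lemma of_mpoly_eq_0_iff [simp]: "of_mpoly p = 0 \<longleftrightarrow> p = 0"
  by (simp add: of_mpoly_def Zero_fract_def eq_fract)

lemma of_mpoly_sum: "of_mpoly (sum g A) = (\<Sum>x\<in>A. of_mpoly (g x))"
  by (induction A rule: infinite_finite_induct) (simp_all add: of_mpoly_add)

lemma of_mpoly_prod: "of_mpoly (prod g A) = (\<Prod>x\<in>A. of_mpoly (g x))"
  by (induction A rule: infinite_finite_induct) (simp_all add: of_mpoly_mult)

lemma Fract_eq_of_mpoly: "q \<noteq> 0 \<Longrightarrow> Fract p q = of_mpoly p / of_mpoly q"
  by (simp add: of_mpoly_def)

lemma rconst_eq_of_mpoly: "rconst c = of_mpoly (Poly_Mapping.single 0 c)"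
  by (simp add: rconst_def of_mpoly_def)

lemma rvar_eq_of_mpoly: "rvar i = of_mpoly (Poly_Mapping.single (Poly_Mapping.single i 1) 1)"
  by (simp add: rvar_def of_mpoly_def)

lemma rconst_zero: "rconst 0 = 0" and rconst_one: "rconst 1 = 1"
  and rconst_add: "rconst (a + b) = rconst a + rconst b"
  and rconst_uminus: "rconst (- a) = - rconst a"
  and rconst_mult: "rconst (a * b) = rconst a * rconst b"
  by (simp_all add: rconst_eq_of_mpoly single_add single_uminus of_mpoly_add of_mpoly_uminus
        mult_single flip: of_mpoly_mult)

lemma rconst_diff: "rconst (a - b) = rconst a - rconst b"
  using rconst_add[of a "- b"] by (simp add: rconst_uminus)

lemma rconst_inverse: "rconst (inverse a) = inverse (rconst a)"
proof (cases "a = 0")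
  case False
  then have "rconst a * rconst (inverse a) = 1"
    by (simp add: rconst_one flip: rconst_mult)
  then show ?thesis by (metis inverse_unique)
qed (simp add: rconst_zero)

lemma rconst_power: "rconst (a ^ k) = rconst a ^ k"
  by (induction k) (simp_all add: rconst_one rconst_mult)

lemma rconst_powi: "rconst (a powi k) = rconst a powi k"
  by (simp add: power_int_def rconst_power rconst_inverse)

lemma rconst_prod: "rconst (prod g A) = (\<Prod>x\<in>A. rconst (g x))"
  by (induction A rule: infinite_finite_induct) (simp_all add: rconst_one rconst_mult)

lemma is_subfield_rconst_image:
  assumes "is_subfield F" shows "is_subfield (rconst ` F)"
  unfolding is_subfield_def ball_simps
proof (intro conjI ballI impI)
  show "0 \<in> rconst ` F" using subfield_zero[OF assms] by (metis rconst_zero imageI)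
  show "1 \<in> rconst ` F" using subfield_one[OF assms] by (metis rconst_one imageI)
qed (simp_all add: subfield_add[OF assms] subfield_uminus[OF assms] subfield_mult[OF assms]
       subfield_inverse[OF assms] flip: rconst_add rconst_uminus rconst_mult rconst_inverse)

lemma rvar_nonzero [simp]: "rvar i \<noteq> 0"
  by (simp add: rvar_eq_of_mpoly flip: Poly_Mapping.keys_eq_empty)

lemma ratfun_monomial_nonzero [simp]: "ratfun_monomial m \<noteq> 0"
  by (simp add: ratfun_monomial_def)

lemma of_mpoly_single: "of_mpoly (Poly_Mapping.single m c) = rconst c * ratfun_monomial m"
proof -
  have pow: "of_mpoly (Poly_Mapping.single (Poly_Mapping.single i k) 1) = rvar i ^ k"
    for i :: 'a and k
  proof (induction k)
    case (Suc k)
    have "Poly_Mapping.single (Poly_Mapping.single i (Suc k)) 1 =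
          Poly_Mapping.single (Poly_Mapping.single i 1) (1::complex) *
          Poly_Mapping.single (Poly_Mapping.single i k) 1"
      by (simp add: mult_single flip: single_add)
    then show ?case using Suc by (simp add: of_mpoly_mult rvar_eq_of_mpoly)
  qed simp
  have prod: "Poly_Mapping.single (sum g A) (1::complex) = (\<Prod>i\<in>A. Poly_Mapping.single (g i) 1)"
    for g :: "'a \<Rightarrow> 'a \<Rightarrow>\<^sub>0 nat" and A
    by (induction A rule: infinite_finite_induct) (simp_all add: mult_single[of _ "1::complex" _ 1, unfolded mult_1, symmetric] del: mult_single)
  have m: "m = (\<Sum>i\<in>UNIV. Poly_Mapping.single i (Poly_Mapping.lookup m i))"
    by (rule poly_mapping_eqI) (simp add: lookup_sum lookup_single when_def)
  have "of_mpoly (Poly_Mapping.single m 1) = ratfun_monomial m"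
    by (subst m) (simp add: prod of_mpoly_prod pow ratfun_monomial_def)
  moreover have "Poly_Mapping.single m c = Poly_Mapping.single 0 c * Poly_Mapping.single m 1"
    by (simp add: mult_single)
  ultimately show ?thesis by (simp add: of_mpoly_mult rconst_eq_of_mpoly)
qed

lemma of_mpoly_expand:
  "of_mpoly p = (\<Sum>m\<in>Poly_Mapping.keys p. rconst (Poly_Mapping.lookup p m) * ratfun_monomial m)"
proof -
  have "p = (\<Sum>m\<in>Poly_Mapping.keys p. Poly_Mapping.single m (Poly_Mapping.lookup p m))"
    by (rule poly_mapping_eqI)
       (simp add: lookup_sum lookup_single when_def in_keys_iff)
  then have "of_mpoly p =
      (\<Sum>m\<in>Poly_Mapping.keys p. of_mpoly (Poly_Mapping.single m (Poly_Mapping.lookup p m)))"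
    using of_mpoly_sum by metis
  then show ?thesis by (simp add: of_mpoly_single)
qed

section \<open>Rational functions over a subfield\<close>

context
  fixes F :: "complex set"
  assumes F: "is_subfield F"
begin

lemma polys_over_single: "c \<in> F \<Longrightarrow> Poly_Mapping.single m c \<in> polys_over F"
  and polys_over_add: "p \<in> polys_over F \<Longrightarrow> q \<in> polys_over F \<Longrightarrow> p + q \<in> polys_over F"
  and polys_over_uminus: "p \<in> polys_over F \<Longrightarrow> - p \<in> polys_over F"
  using subfield_zero[OF F] subfield_add[OF F] subfield_uminus[OF F]
  by (auto simp: polys_over_def lookup_add lookup_single when_def)

lemma polys_over_mult:
  assumes "p \<in> polys_over F" "q \<in> polys_over F" shows "p * q \<in> polys_over F"
proof -
  have "Poly_Mapping.lookup (p * q) m \<in> F" for m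
    unfolding lookup_mult Sum_any.expand_set using assms
    by (intro subfield_sum[OF F] subfield_mult[OF F])
       (auto simp: polys_over_def when_def subfield_zero[OF F])
  then show ?thesis by (simp add: polys_over_def)
qed

lemma ratfuns_over_eq:
  "ratfuns_over F = {of_mpoly p / of_mpoly q | p q. p \<in> polys_over F \<and> q \<in> polys_over F \<and> q \<noteq> 0}"
  unfolding ratfuns_over_def
  by (intro Collect_cong ex_cong1) (auto simp: Fract_eq_of_mpoly)

lemma Fract_in_ratfuns_over:
  "p \<in> polys_over F \<Longrightarrow> q \<in> polys_over F \<Longrightarrow> q \<noteq> 0 \<Longrightarrow> Fract p q \<in> ratfuns_over F"
  unfolding ratfuns_over_def by blast

lemma of_mpoly_in_ratfuns_over: "p \<in> polys_over F \<Longrightarrow> of_mpoly p \<in> ratfuns_over F"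
  unfolding of_mpoly_def
  by (rule Fract_in_ratfuns_over)
     (use polys_over_single[OF subfield_one[OF F], of 0] in simp_all)

lemma rconst_in_ratfuns_over: "c \<in> F \<Longrightarrow> rconst c \<in> ratfuns_over F"
  by (simp add: rconst_eq_of_mpoly of_mpoly_in_ratfuns_over polys_over_single)

lemma rvar_in_ratfuns_over: "rvar i \<in> ratfuns_over F"
  by (simp add: rvar_eq_of_mpoly of_mpoly_in_ratfuns_over polys_over_single subfield_one[OF F])

lemma is_subfield_ratfuns_over: "is_subfield (ratfuns_over F :: 'n::{finite,linorder} ratfun set)"
  unfolding is_subfield_def
proof (intro conjI ballI impI)
  show "0 \<in> (ratfuns_over F :: 'n ratfun set)" "1 \<in> (ratfuns_over F :: 'n ratfun set)"
    using rconst_in_ratfuns_over subfield_zero[OF F] subfield_one[OF F] rconst_zero rconst_one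
    by metis+
next
  fix x y :: "'n ratfun" assume xy: "x \<in> ratfuns_over F" "y \<in> ratfuns_over F"
  then obtain p q p' q' where *: "x = Fract p q" "y = Fract p' q'" "q \<noteq> 0" "q' \<noteq> 0"
    "p \<in> polys_over F" "q \<in> polys_over F" "p' \<in> polys_over F" "q' \<in> polys_over F"
    unfolding ratfuns_over_def by auto
  then have "x + y = Fract (p * q' + p' * q) (q * q')" "x * y = Fract (p * p') (q * q')" by auto
  then show "x + y \<in> ratfuns_over F" "x * y \<in> ratfuns_over F"
    using * by (simp_all add: Fract_in_ratfuns_over polys_over_add polys_over_mult)
next
  fix x :: "'n ratfun" assume "x \<in> ratfuns_over F"
  then obtain p q where *: "x = Fract p q" "q \<noteq> 0" "p \<in> polys_over F" "q \<in> polys_over F"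
    unfolding ratfuns_over_def by auto
  show "- x \<in> ratfuns_over F"
    using * by (simp add: Fract_in_ratfuns_over polys_over_uminus)
  assume "x \<noteq> 0"
  then have "p \<noteq> 0" "inverse x = Fract q p" using * by (auto simp: fract_collapse)
  then show "inverse x \<in> ratfuns_over F"
    using * by (simp add: Fract_in_ratfuns_over)
qed

lemma ratfun_monomial_in_ratfuns_over: "ratfun_monomial m \<in> ratfuns_over F"
  unfolding ratfun_monomial_def
  by (intro subfield_prod subfield_power is_subfield_ratfuns_over rvar_in_ratfuns_over)

end

section \<open>Laurent monomials and the exponent lattice\<close>

lemma laurent_monomial_in_ratfuns_over: "is_subfield F \<Longrightarrow> laurent_monomial v \<in> ratfuns_over F"
  unfolding laurent_monomial_def
  by (intro subfield_prod subfield_powi is_subfield_ratfuns_over rvar_in_ratfuns_over)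

lemma laurent_monomial_zero: "laurent_monomial 0 = 1"
  by (simp add: laurent_monomial_def)

lemma laurent_monomial_add: "laurent_monomial (a + b) = laurent_monomial a * laurent_monomial b"
  by (simp add: laurent_monomial_def power_int_add prod.distrib)

lemma laurent_monomial_scale: "laurent_monomial (k *s a) = laurent_monomial a powi k"
proof -
  have "(\<Prod>i\<in>A. g i :: 'a ratfun) powi k = (\<Prod>i\<in>A. g i powi k)" for g and A :: "'a set"
    by (induction A rule: infinite_finite_induct) (simp_all add: power_int_mult_distrib)
  then show ?thesis by (simp add: laurent_monomial_def mult.commute[of k] power_int_mult)
qed

lemma laurent_monomial_diff_exponents:
  "laurent_monomial (\<chi> i. int (Poly_Mapping.lookup m i) - int (Poly_Mapping.lookup m' i)) =
   ratfun_monomial m / ratfun_monomial m'"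
  by (simp add: laurent_monomial_def ratfun_monomial_def power_int_diff prod_dividef)

lemma laurent_monomial_span:
  assumes "is_subfield K" "laurent_monomial ` B \<subseteq> K" "v \<in> int_vec.span B"
  shows "laurent_monomial v \<in> K"
  using assms(3)
proof (induction rule: int_vec.span_induct_alt)
  case base
  show ?case by (simp add: laurent_monomial_zero subfield_one[OF assms(1)])
next
  case (step c x y)
  then show ?case using assms(2)
    by (auto simp: laurent_monomial_add laurent_monomial_scale
        intro!: subfield_mult[OF assms(1)] subfield_powi[OF assms(1)])
qed

lemma subspace_exponent_lattice:
  assumes "\<And>i. lam $ i \<noteq> 0" shows "int_vec.subspace (exponent_lattice lam)"
proof -
  have "(\<Prod>i\<in>A. g i :: complex) powi k = (\<Prod>i\<in>A. g i powi k)" for g k and A :: "'a set"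
    by (induction A rule: infinite_finite_induct) (simp_all add: power_int_mult_distrib)
  then have "(\<Prod>i\<in>UNIV. lam $ i powi (k * v $ i)) = (\<Prod>i\<in>UNIV. lam $ i powi v $ i) powi k" for k v
    by (simp add: mult.commute[of k] power_int_mult)
  then show ?thesis using assms
    by (auto simp: int_vec.subspace_def exponent_lattice_def power_int_add prod.distrib)
qed

section \<open>Finite bases of subgroups of the integer lattice\<close>

text \<open>
  A generalisation of the next lemma that allows induction on the set of coordinates in which
  vectors may be nonzero.  The values of coordinate \<open>i\<close> on the
  subgroup form a subgroup of \<open>\<int>\<close>, generated by its least positive element; a vector \<open>u\<close> attaining
  it complements a basis of the vectors with vanishing coordinate \<open>i\<close>.
\<close>

lemma int_subspace_supported_has_finite_basis:
  assumes "finite S" "int_vec.subspace U" "\<And>v i. v \<in> U \<Longrightarrow> i \<notin> S \<Longrightarrow> v $ i = (0::int)"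
  shows "\<exists>B. finite B \<and> is_int_basis B (U :: (int ^ 'n::finite) set)"
  using assms
proof (induction S arbitrary: U rule: finite_induct)
  case empty
  then have "U = {0}"
    using int_vec.subspace_0 by (auto simp: vec_eq_iff)
  then show ?case
    by (intro exI[of _ "{}"]) (simp add: is_int_basis_def int_vec.independent_empty)
next
  case (insert i S)
  define U' where "U' = {v \<in> U. v $ i = 0}"
  have "int_vec.subspace U'"
    using insert.prems(1) by (auto simp: U'_def int_vec.subspace_def)
  moreover have "v $ j = 0" if "v \<in> U'" "j \<notin> S" for v j
    using that insert.prems(2)[of v j] by (cases "j = i") (auto simp: U'_def)
  ultimately obtain B where B: "finite B" "int_vec.independent B" "int_vec.span B = U'"
    using insert.IH unfolding is_int_basis_def by blast
  show ?case
  proof (cases "U' = U")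
    case True
    then show ?thesis using B by (auto simp: is_int_basis_def)
  next
    case False
    then obtain v where v: "v \<in> U" "v $ i \<noteq> 0" by (auto simp: U'_def)
    define P where "P k \<longleftrightarrow> k > 0 \<and> (\<exists>u\<in>U. u $ i = int k)" for k
    have "- v \<in> U" using v insert.prems(1) by (simp add: int_vec.subspace_neg)
    then have "P (nat \<bar>v $ i\<bar>)"
      using v unfolding P_def by (cases "v $ i > 0") (force, force)
    define d where "d = (LEAST k. P k)"
    have "P d" unfolding d_def by (rule LeastI) fact
    obtain u where u: "u \<in> U" "u $ i = int d" "d > 0"
      using \<open>P d\<close> by (auto simp: P_def)
    have dvd: "int d dvd w $ i" if "w \<in> U" for w
    proof (rule ccontr)
      assume nd: "\<not> int d dvd w $ i"
      define w' where "w' = w - (w $ i div int d) *s u"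
      have "w' \<in> U" unfolding w'_def
        using that u insert.prems(1) int_vec.subspace_diff int_vec.subspace_scale by blast
      moreover have "w' $ i = w $ i mod int d"
        by (simp add: w'_def u minus_div_mult_eq_mod)
      moreover have "w $ i mod int d \<noteq> 0" using nd mod_0_imp_dvd by blast
      then have pos: "0 < w $ i mod int d"
        using pos_mod_sign[of "int d" "w $ i"] u(3) by linarith
      ultimately have "P (nat (w $ i mod int d))"
        unfolding P_def using int_nat_eq by (intro conjI bexI[of _ w']) auto
      moreover have "nat (w $ i mod int d) < d"
        using pos pos_mod_bound[of "int d" "w $ i"] u(3) by linarith
      ultimately show False using not_less_Least unfolding d_def by blast
    qed
    have "int_vec.span (insert u B) = U"
    proof (rule int_vec.span_subspace)
      show "insert u B \<subseteq> U"
        using u B(3) int_vec.span_superset[of B] by (auto simp: U'_def)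
      show "U \<subseteq> int_vec.span (insert u B)"
      proof
        fix w assume w: "w \<in> U"
        then have "w - (w $ i div int d) *s u \<in> U"
          using u insert.prems(1) int_vec.subspace_diff int_vec.subspace_scale by blast
        then have "w - (w $ i div int d) *s u \<in> U'"
          using dvd[OF w] u by (simp add: U'_def)
        then show "w \<in> int_vec.span (insert u B)"
          using B(3) int_vec.span_breakdown_eq by blast
      qed
    qed (rule insert.prems(1))
    moreover have "int_vec.independent (insert u B)"
      unfolding int_vec.independent_explicit_module
    proof (intro allI impI)
      fix T c w
      assume T: "finite T" "T \<subseteq> insert u B" "(\<Sum>v\<in>T. c v *s v) = 0" "w \<in> T"
      have B0: "x $ i = 0" if "x \<in> B" for x
        using that B(3) int_vec.span_superset[of B] by (auto simp: U'_def)
      \<comment> \<open>Only \<open>u\<close> contributes to coordinate \<open>i\<close> of the relation.\<close>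
      have cu: "c u = 0" if "u \<in> T"
      proof -
        have "0 = (\<Sum>v\<in>T. c v *s v) $ i" using T by simp
        also have "\<dots> = (\<Sum>v\<in>T. c v * v $ i)" by simp
        also have "\<dots> = (\<Sum>v\<in>{u}. c v * v $ i)"
          using T that B0 by (intro sum.mono_neutral_right) auto
        finally show ?thesis using u by simp
      qed
      have "(\<Sum>v\<in>T - {u}. c v *s v) = (\<Sum>v\<in>T. c v *s v)"
        using T(1) cu by (intro sum.mono_neutral_left) auto
      then have "(\<Sum>v\<in>T - {u}. c v *s v) = 0" using T by simp
      moreover have "finite (T - {u})" "T - {u} \<subseteq> B" using T by auto
      ultimately have "x \<in> T - {u} \<Longrightarrow> c x = 0" for x
        using B(2) unfolding int_vec.independent_explicit_module by blast
      then show "c w = 0" using T(4) cu by blast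
    qed
    ultimately show ?thesis
      using B(1) by (auto simp: is_int_basis_def)
  qed
qed

lemma int_subspace_has_finite_basis:
  assumes "int_vec.subspace U"
  shows "\<exists>B. finite B \<and> is_int_basis B (U :: (int ^ 'n::finite) set)"
  by (rule int_subspace_supported_has_finite_basis[of UNIV]) (use assms in auto)

text \<open>
  The rank is the cardinality of a chosen finite basis, so it is only meaningful once such a basis
  is known to exist.
\<close>

lemma lattice_rank_0_imp_trivial:
  assumes "int_vec.subspace U" "lattice_rank U = 0"
  shows "int_vec.span {} = U"
proof -
  have "finite (SOME B. finite B \<and> is_int_basis B U) \<and> is_int_basis (SOME B. finite B \<and> is_int_basis B U) U"
    using int_subspace_has_finite_basis[OF assms(1)] by (rule someI_ex)
  with assms(2) have "is_int_basis {} U"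
    unfolding lattice_rank_def by (metis card_0_eq)
  then show ?thesis by (simp add: is_int_basis_def)
qed

section \<open>The constant field of a diagonal automorphism\<close>

text \<open>
  With \<open>w = character\<close> this is the action of \<open>\<sigma>\<close> on polynomials, and with
  \<open>w m = character m - c\<close> it is \<open>\<sigma> - c\<close>.
\<close>

definition reweight ::
    "(('n \<Rightarrow>\<^sub>0 nat) \<Rightarrow> complex) \<Rightarrow> 'n::{finite,linorder} mpolynomial \<Rightarrow> 'n mpolynomial" where
  "reweight w = Poly_Mapping.mapp (\<lambda>m c. w m * c)"

lemma lookup_reweight: "Poly_Mapping.lookup (reweight w p) m = w m * Poly_Mapping.lookup p m"
  by (simp add: reweight_def lookup_mapp when_def in_keys_iff)

lemma keys_reweight:
  "Poly_Mapping.keys (reweight w p) = {m \<in> Poly_Mapping.keys p. w m \<noteq> 0}"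
  by (auto simp: in_keys_iff lookup_reweight)

lemma of_mpoly_reweight:
  "of_mpoly (reweight w p) =
   (\<Sum>m\<in>Poly_Mapping.keys p. rconst (w m) * (rconst (Poly_Mapping.lookup p m) * ratfun_monomial m))"
proof -
  have "of_mpoly (reweight w p) = (\<Sum>m\<in>Poly_Mapping.keys (reweight w p).
          rconst (Poly_Mapping.lookup (reweight w p) m) * ratfun_monomial m)"
    by (rule of_mpoly_expand)
  also have "\<dots> = (\<Sum>m\<in>Poly_Mapping.keys p.
          rconst (Poly_Mapping.lookup (reweight w p) m) * ratfun_monomial m)"
    by (rule sum.mono_neutral_left) (auto simp: keys_reweight lookup_reweight rconst_zero)
  finally show ?thesis by (simp add: lookup_reweight rconst_mult mult.assoc)
qed

lemma of_mpoly_reweight_diff: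
  "of_mpoly (reweight (\<lambda>m. w m - c) p) = of_mpoly (reweight w p) - rconst c * of_mpoly p"
  unfolding of_mpoly_reweight of_mpoly_expand[of p]
  by (simp add: rconst_diff sum_distrib_left left_diff_distrib flip: sum_subtractf)

locale diagonal_automorphism =
  fixes F :: "complex set" and lam :: "complex ^ 'n::{finite,linorder}"
    and \<sigma> :: "'n ratfun \<Rightarrow> 'n ratfun"
  assumes F: "is_subfield F"
    and lam_in: "lam $ i \<in> F" and lam_nonzero: "lam $ i \<noteq> 0"
    and automorphism: "field_automorphism_on (ratfuns_over F) \<sigma>"
    and fixes_consts: "c \<in> F \<Longrightarrow> \<sigma> (rconst c) = rconst c"
    and scales_vars: "\<sigma> (rvar i) = rconst (lam $ i) * rvar i"
begin

sublocale subfield_hom "ratfuns_over F" \<sigma>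
  using automorphism is_subfield_ratfuns_over[OF F]
  by unfold_locales (auto simp: field_automorphism_on_def)

definition character :: "('n \<Rightarrow>\<^sub>0 nat) \<Rightarrow> complex" where
  "character m = (\<Prod>i\<in>UNIV. lam $ i ^ Poly_Mapping.lookup m i)"

lemma character_in: "character m \<in> F"
  unfolding character_def by (intro subfield_prod[OF F] subfield_power[OF F] lam_in)

lemma character_nonzero: "character m \<noteq> 0"
  by (simp add: character_def lam_nonzero)

lemma sigma_monomial: "\<sigma> (ratfun_monomial m) = rconst (character m) * ratfun_monomial m"
  unfolding ratfun_monomial_def character_def rconst_prod rconst_power prod.distrib[symmetric]
  by (subst hom_prod)
     (simp_all add: hom_power scales_vars power_mult_distrib rvar_in_ratfuns_over[OF F]
        subfield_power[OF subfield])

lemma sigma_of_mpoly: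
  assumes "p \<in> polys_over F"
  shows "\<sigma> (of_mpoly p) = of_mpoly (reweight character p)"
proof -
  have c: "Poly_Mapping.lookup p m \<in> F" for m using assms by (simp add: polys_over_def)
  note in_K = rconst_in_ratfuns_over[OF F c] ratfun_monomial_in_ratfuns_over[OF F]
  show ?thesis
    unfolding of_mpoly_reweight of_mpoly_expand[of p]
    by (subst hom_sum)
       (simp_all add: in_K hom_mult subfield_mult[OF subfield] fixes_consts c sigma_monomial
          mult.left_commute)
qed

lemma sigma_laurent_monomial:
  "\<sigma> (laurent_monomial v) = rconst (\<Prod>i\<in>UNIV. lam $ i powi v $ i) * laurent_monomial v"
  unfolding laurent_monomial_def rconst_prod rconst_powi prod.distrib[symmetric]
  by (subst hom_prod)
     (simp_all add: hom_powi scales_vars power_int_mult_distrib rvar_in_ratfuns_over[OF F]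
        subfield_powi[OF subfield])

lemma laurent_monomial_in_const_field:
  "v \<in> exponent_lattice lam \<Longrightarrow> laurent_monomial v \<in> const_field F \<sigma>"
  by (auto simp: const_field_def sigma_laurent_monomial exponent_lattice_def rconst_one
      laurent_monomial_in_ratfuns_over[OF F])

text \<open>
  This is how lattice vectors arise from polynomials: as differences of exponents of two monomials
  on which \<open>\<sigma>\<close> acts by the same scalar.
\<close>

lemma character_eq_imp_lattice:
  assumes "character m = character m'"
  shows "(\<chi> i. int (Poly_Mapping.lookup m i) - int (Poly_Mapping.lookup m' i))
         \<in> exponent_lattice lam"
  using assms character_nonzero[of m']
  by (simp add: exponent_lattice_def character_def power_int_diff lam_nonzero prod_dividef)

text \<open>
  The heart of the proof: among all representations of a fixed element as a quotient, one whose
  denominator has the fewest monomials is homogeneous for the grading by \<open>character\<close>, because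
  subtracting \<open>c\<close> times the representation from its image under \<open>\<sigma>\<close> removes every
  monomial of weight \<open>c\<close>.
\<close>

lemma fixed_imp_isotypic_quotient:
  assumes "f \<in> const_field F \<sigma>"
  obtains p q c where "p \<in> polys_over F" "q \<in> polys_over F" "q \<noteq> 0"
    "f = of_mpoly p / of_mpoly q"
    "\<And>m. m \<in> Poly_Mapping.keys p \<union> Poly_Mapping.keys q \<Longrightarrow> character m = c"
proof -
  define rep where "rep pq \<longleftrightarrow> fst pq \<in> polys_over F \<and> snd pq \<in> polys_over F \<and> snd pq \<noteq> 0
    \<and> f = of_mpoly (fst pq) / of_mpoly (snd pq)" for pq
  define size where "size pq = card (Poly_Mapping.keys (snd pq))"
    for pq :: "'n mpolynomial \<times> 'n mpolynomial"
  have f: "f \<in> ratfuns_over F" "\<sigma> f = f" using assms by (auto simp: const_field_def)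
  then obtain pq0 where "rep pq0" by (auto simp: ratfuns_over_eq[OF F] rep_def)
  then obtain pq where pq: "rep pq" "\<And>pq'. rep pq' \<Longrightarrow> size pq \<le> size pq'"
    using ex_has_least_nat[of rep pq0 size] by blast
  define p q where "p = fst pq" and "q = snd pq"
  have p: "p \<in> polys_over F" and q: "q \<in> polys_over F" and q0: "q \<noteq> 0"
    and f_eq: "f = of_mpoly p / of_mpoly q"
    using pq(1) by (auto simp: rep_def p_def q_def)
  obtain m0 where m0: "m0 \<in> Poly_Mapping.keys q" using q0 by fastforce
  define c where "c = character m0"
  define p' q' where "p' = reweight (\<lambda>m. character m - c) p"
    and "q' = reweight (\<lambda>m. character m - c) q"
  have in_F: "p' \<in> polys_over F" "q' \<in> polys_over F"
    using p q unfolding p'_def q'_def polys_over_def c_def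
    by (auto simp: lookup_reweight
        intro!: subfield_mult[OF F] subfield_diff[OF F] character_in)
  have "f = of_mpoly (reweight character p) / of_mpoly (reweight character q)"
    using f(2) f_eq hom_divide p q
    by (simp add: sigma_of_mpoly of_mpoly_in_ratfuns_over[OF F])
  moreover have "of_mpoly (reweight character q) \<noteq> 0"
    using m0 character_nonzero
    by (metis (mono_tags, lifting) empty_iff keys_reweight keys_zero mem_Collect_eq of_mpoly_eq_0_iff)
  ultimately have "of_mpoly (reweight character p) = f * of_mpoly (reweight character q)"
    by simp
  moreover have "of_mpoly p = f * of_mpoly q" using f_eq q0 by simp
  ultimately have cross: "of_mpoly p' = f * of_mpoly q'"
    unfolding p'_def q'_def of_mpoly_reweight_diff by (simp add: right_diff_distrib)
  have "q' = 0"
  proof (rule ccontr)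
    assume "q' \<noteq> 0"
    then have "rep (p', q')" using in_F cross by (simp add: rep_def)
    then have "size pq \<le> size (p', q')" by (rule pq(2))
    moreover have "Poly_Mapping.keys q' \<subset> Poly_Mapping.keys q"
      using m0 by (auto simp: q'_def keys_reweight c_def)
    then have "card (Poly_Mapping.keys q') < card (Poly_Mapping.keys q)"
      by (intro psubset_card_mono) simp_all
    ultimately show False by (simp add: size_def q_def)
  qed
  with cross have "p' = 0" by simp
  have "character m = c" if "m \<in> Poly_Mapping.keys p \<union> Poly_Mapping.keys q" for m
    using that \<open>p' = 0\<close> \<open>q' = 0\<close> keys_reweight[of "\<lambda>m. character m - c"]
    unfolding p'_def q'_def by (metis (mono_tags, lifting) UnE empty_iff keys_zero mem_Collect_eq right_minus_eq)
  then show thesis using that p q q0 f_eq by blast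
qed

text \<open>
  Cancelling one monomial of the denominator from both sides of a homogeneous quotient leaves
  Laurent polynomials supported on the lattice.
\<close>

lemma const_field_eq_generated:
  assumes span: "int_vec.span B = exponent_lattice lam"
  shows "const_field F \<sigma> = field_generated_over F (laurent_monomial ` B)"
proof
  let ?G = "field_generated_over F (laurent_monomial ` B)"
  have G: "is_subfield ?G"
    unfolding field_generated_over_def by (rule is_subfield_hull)
  have gens: "rconst ` F \<union> laurent_monomial ` B \<subseteq> ?G"
    unfolding field_generated_over_def by (rule hull_subset)
  have "laurent_monomial ` B \<subseteq> const_field F \<sigma>"
    using laurent_monomial_in_const_field span int_vec.span_superset[of B] by blast
  moreover have "rconst ` F \<subseteq> const_field F \<sigma>"
    using rconst_in_ratfuns_over[OF F] fixes_consts by (auto simp: const_field_def)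
  ultimately show "?G \<subseteq> const_field F \<sigma>"
    using fixed_subfield unfolding field_generated_over_def
    by (intro hull_minimal) (auto simp: const_field_def)
  show "const_field F \<sigma> \<subseteq> ?G"
  proof
    fix f assume "f \<in> const_field F \<sigma>"
    then obtain p q c where pq: "p \<in> polys_over F" "q \<in> polys_over F" "q \<noteq> 0"
      and f: "f = of_mpoly p / of_mpoly q"
      and c: "\<And>m. m \<in> Poly_Mapping.keys p \<union> Poly_Mapping.keys q \<Longrightarrow> character m = c"
      using fixed_imp_isotypic_quotient by metis
    obtain m0 where m0: "m0 \<in> Poly_Mapping.keys q" using pq(3) by fastforce
    have shifted: "of_mpoly g / ratfun_monomial m0 \<in> ?G"
      if g: "g \<in> polys_over F" "Poly_Mapping.keys g \<subseteq> Poly_Mapping.keys p \<union> Poly_Mapping.keys q"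
      for g
    proof -
      have "ratfun_monomial m / ratfun_monomial m0 \<in> ?G" if "m \<in> Poly_Mapping.keys g" for m
      proof -
        have "character m = character m0" using c[of m] c[of m0] m0 g(2) that by auto
        from laurent_monomial_span[OF G _ character_eq_imp_lattice[OF this, folded span]]
        show ?thesis using gens by (simp add: laurent_monomial_diff_exponents)
      qed
      moreover have "rconst (Poly_Mapping.lookup g m) \<in> ?G" for m
        using gens g(1) by (auto simp: polys_over_def)
      ultimately have "(\<Sum>m\<in>Poly_Mapping.keys g. rconst (Poly_Mapping.lookup g m) *
          (ratfun_monomial m / ratfun_monomial m0)) \<in> ?G"
        by (intro subfield_sum[OF G] subfield_mult[OF G])
      then show ?thesis by (simp add: of_mpoly_expand[of g] sum_divide_distrib)
    qed
    have "f = (of_mpoly p / ratfun_monomial m0) / (of_mpoly q / ratfun_monomial m0)"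
      by (simp add: f)
    then show "f \<in> ?G"
      using subfield_divide[OF G shifted[OF pq(1)] shifted[OF pq(2)]] by auto
  qed
qed

end

theorem theorem2p4:
  fixes F :: "complex set"
    and lam :: "(complex, 'n::{finite,linorder}) vec"
    and \<sigma> :: "'n::{finite,linorder} ratfun \<Rightarrow> 'n ratfun"
    and r :: nat
  assumes "is_subfield F" and "F \<subseteq> {z. algebraic z}"
    and "\<forall>i. lam $ i \<in> F - {0}"
    and "field_automorphism_on (ratfuns_over F) \<sigma>"
    and "\<forall>c\<in>F. \<sigma> (rconst c) = rconst c"
    and "\<forall>i. \<sigma> (rvar i) = rconst (lam $ i) * rvar i"
    and "r = lattice_rank (exponent_lattice lam)"
  shows "(r = 0 \<longrightarrow> const_field F \<sigma> = rconst ` F) \<and>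
    (r > 0 \<longrightarrow> (\<forall>a :: nat \<Rightarrow> (int, 'n) vec.
       is_int_basis (a ` {1..r}) (exponent_lattice lam) \<longrightarrow>
       const_field F \<sigma> = field_generated_over F {laurent_monomial (a i) | i. i \<in> {1..r}}))"
proof -
  interpret diagonal_automorphism F lam \<sigma>
    using assms by unfold_locales auto
  show ?thesis
  proof (intro conjI impI allI)
    assume "r = 0"
    then have "int_vec.span {} = exponent_lattice lam"
      using lattice_rank_0_imp_trivial subspace_exponent_lattice lam_nonzero assms(7) by metis
    then have "const_field F \<sigma> = is_subfield hull (rconst ` F)"
      using const_field_eq_generated[of "{}"] by (simp add: field_generated_over_def)
    also have "\<dots> = rconst ` F"
      by (rule hull_same) (rule is_subfield_rconst_image[OF F])
    finally show "const_field F \<sigma> = rconst ` F" .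
  next
    fix a :: "nat \<Rightarrow> (int, 'n) vec"
    assume "is_int_basis (a ` {1..r}) (exponent_lattice lam)"
    then have "const_field F \<sigma> = field_generated_over F (laurent_monomial ` a ` {1..r})"
      by (intro const_field_eq_generated) (simp add: is_int_basis_def)
    also have "laurent_monomial ` a ` {1..r} = {laurent_monomial (a i) | i. i \<in> {1..r}}" by auto
    finally show "const_field F \<sigma> =
        field_generated_over F {laurent_monomial (a i) | i. i \<in> {1..r}}" .
  qed
qed

end
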